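(* For any $c>0$ there exists $n\in\mathbb N$ such that for every permutation $\varphi\in S_n$, the clique-width of $G_\varphi(n)$ is greater than $c$.
   Context: A $b$-ary tree is a rooted tree in which every vertex has at most $b$ children; the level of a vertex is its distance to the root, and level $\ell$ is filled if it contains $b^\ell$ vertices; $n_x$ is the number of vertices in the subtree rooted at $x$. A $b$-ary tree is balanced if every non-empty level except possibly the last non-empty one is filled, and $|n_x-n_y|\le1$ for any two vertices $x,y$ on the same level. For $b\in\{2,3\}$, $T_b(n)$ denotes a fixed balanced $b$-ary tree with vertex set $[n]=\{1,\dots,n\}$ (such trees exist and are unique up to isomorphism). For $\varphi\in S_n$, $G_\varphi(n)$ is the union of $T_2(n)$ and $T_3(n)$ along $\varphi$, i.e., the graph on $[n]$ with edge set $\{\{\varphi(i),\varphi(j)\}:\{i,j\}\in E(T_2(n))\}\cup E(T_3(n))$. Clique-width is the standard graph parameter. *)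

theory Defs
  imports Complex_Main "HOL-Combinatorics.Permutations"
begin

section \<open>Simple graphs and rooted trees\<close>

text \<open>A graph is given by its vertex set and its set of edges, each edge being a two-element set
  of vertices.\<close>

definition simple_graph :: "'a set \<Rightarrow> 'a set set \<Rightarrow> bool" where
  "simple_graph V E \<longleftrightarrow> finite V \<and> (\<forall>e\<in>E. e \<subseteq> V \<and> card e = 2)"

definition adj :: "'a set set \<Rightarrow> ('a \<times> 'a) set" where
  "adj E = {(x, y). {x, y} \<in> E}"

definition connected_graph :: "'a set \<Rightarrow> 'a set set \<Rightarrow> bool" where
  "connected_graph V E \<longleftrightarrow> V \<noteq> {} \<and> (\<forall>x\<in>V. \<forall>y\<in>V. (x, y) \<in> (adj E)\<^sup>*)"

definition is_cycle :: "'a set set \<Rightarrow> 'a list \<Rightarrow> bool" where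
  "is_cycle E xs \<longleftrightarrow> length xs \<ge> 3 \<and> distinct xs \<and>
     successively (\<lambda>x y. {x, y} \<in> E) xs \<and> {last xs, hd xs} \<in> E"

definition is_tree :: "'a set \<Rightarrow> 'a set set \<Rightarrow> bool" where
  "is_tree V E \<longleftrightarrow> simple_graph V E \<and> connected_graph V E \<and> (\<nexists>xs. is_cycle E xs)"

definition graph_dist :: "'a set set \<Rightarrow> 'a \<Rightarrow> 'a \<Rightarrow> nat" where
  "graph_dist E x y = (LEAST n. (x, y) \<in> adj E ^^ n)"

definition level :: "'a set \<Rightarrow> 'a set set \<Rightarrow> 'a \<Rightarrow> nat \<Rightarrow> 'a set" where
  "level V E r l = {x \<in> V. graph_dist E r x = l}"

definition child_rel :: "'a set set \<Rightarrow> 'a \<Rightarrow> ('a \<times> 'a) set" where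
  "child_rel E r = {(x, y). {x, y} \<in> E \<and> graph_dist E r y = graph_dist E r x + 1}"

definition subtree :: "'a set set \<Rightarrow> 'a \<Rightarrow> 'a \<Rightarrow> 'a set" where
  "subtree E r x = (child_rel E r)\<^sup>* `` {x}"

definition bary_tree :: "nat \<Rightarrow> 'a set \<Rightarrow> 'a set set \<Rightarrow> 'a \<Rightarrow> bool" where
  "bary_tree b V E r \<longleftrightarrow> is_tree V E \<and> r \<in> V \<and> (\<forall>x\<in>V. card (child_rel E r `` {x}) \<le> b)"

definition balanced_rooted_tree :: "nat \<Rightarrow> 'a set \<Rightarrow> 'a set set \<Rightarrow> 'a \<Rightarrow> bool" where
  "balanced_rooted_tree b V E r \<longleftrightarrow> bary_tree b V E r \<and>
     (\<forall>l. level V E r l \<noteq> {} \<and> (\<exists>m>l. level V E r m \<noteq> {}) \<longrightarrow> card (level V E r l) = b ^ l) \<and>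
     (\<forall>l. \<forall>x\<in>level V E r l. \<forall>y\<in>level V E r l.
        \<bar>int (card (subtree E r x)) - int (card (subtree E r y))\<bar> \<le> 1)"

definition balanced_tree :: "nat \<Rightarrow> 'a set \<Rightarrow> 'a set set \<Rightarrow> bool" where
  "balanced_tree b V E \<longleftrightarrow> (\<exists>r. balanced_rooted_tree b V E r)"

text \<open>Edge set of the union of two graphs on a common vertex set along a permutation.\<close>

definition union_along :: "('a \<Rightarrow> 'a) \<Rightarrow> 'a set set \<Rightarrow> 'a set set \<Rightarrow> 'a set set" where
  "union_along \<phi> E F = {{\<phi> i, \<phi> j} | i j. {i, j} \<in> E} \<union> F"


section \<open>Clique-width\<close>

text \<open>The four operations on labelled graphs: creation of a vertex with a given label, disjoint
  union, joining all vertices labelled \<open>i\<close> to all vertices labelled \<open>j\<close>, and renaming the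
  label \<open>i\<close> to \<open>j\<close>.\<close>

datatype 'a cw_expr =
    Vertex 'a nat
  | DUnion "'a cw_expr" "'a cw_expr"
  | Join nat nat "'a cw_expr"
  | Relabel nat nat "'a cw_expr"

primrec cw_verts :: "'a cw_expr \<Rightarrow> 'a set" where
  "cw_verts (Vertex v i) = {v}"
| "cw_verts (DUnion s t) = cw_verts s \<union> cw_verts t"
| "cw_verts (Join i j t) = cw_verts t"
| "cw_verts (Relabel i j t) = cw_verts t"

text \<open>Only the values at vertices of the expression are meaningful.\<close>

primrec cw_lab :: "'a cw_expr \<Rightarrow> 'a \<Rightarrow> nat" where
  "cw_lab (Vertex v i) = (\<lambda>x. i)"
| "cw_lab (DUnion s t) = (\<lambda>x. if x \<in> cw_verts s then cw_lab s x else cw_lab t x)"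
| "cw_lab (Join i j t) = cw_lab t"
| "cw_lab (Relabel i j t) = (\<lambda>x. if cw_lab t x = i then j else cw_lab t x)"

primrec cw_edges :: "'a cw_expr \<Rightarrow> 'a set set" where
  "cw_edges (Vertex v i) = {}"
| "cw_edges (DUnion s t) = cw_edges s \<union> cw_edges t"
| "cw_edges (Join i j t) = cw_edges t \<union>
     {{x, y} | x y. x \<in> cw_verts t \<and> y \<in> cw_verts t \<and> cw_lab t x = i \<and> cw_lab t y = j}"
| "cw_edges (Relabel i j t) = cw_edges t"

primrec k_expression :: "nat \<Rightarrow> 'a cw_expr \<Rightarrow> bool" where
  "k_expression k (Vertex v i) \<longleftrightarrow> i \<in> {1..k}"
| "k_expression k (DUnion s t) \<longleftrightarrow>
     k_expression k s \<and> k_expression k t \<and> cw_verts s \<inter> cw_verts t = {}"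
| "k_expression k (Join i j t) \<longleftrightarrow> i \<in> {1..k} \<and> j \<in> {1..k} \<and> i \<noteq> j \<and> k_expression k t"
| "k_expression k (Relabel i j t) \<longleftrightarrow> i \<in> {1..k} \<and> j \<in> {1..k} \<and> k_expression k t"

definition clique_width :: "'a set \<Rightarrow> 'a set set \<Rightarrow> nat" where
  "clique_width V E = (LEAST k. \<exists>t. k_expression k t \<and> cw_verts t = V \<and> cw_edges t = E)"

text \<open>The minimum in the definition is attained for every non-empty simple graph.\<close>

lemma k_expression_vertices:
  assumes "finite V" "V \<noteq> {}" "f ` V \<subseteq> {1..k}"
  shows "\<exists>t. k_expression k t \<and> cw_verts t = V \<and> cw_edges t = {} \<and> (\<forall>x\<in>V. cw_lab t x = f x)"
  using assms
proof (induction V rule: finite_ne_induct)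
  case (singleton x)
  then show ?case by (intro exI[of _ "Vertex x (f x)"]) auto
next
  case (insert x V)
  then obtain t where t: "k_expression k t" "cw_verts t = V" "cw_edges t = {}"
      "\<forall>y\<in>V. cw_lab t y = f y"
    by auto
  with insert show ?case by (intro exI[of _ "DUnion (Vertex x (f x)) t"]) auto
qed

lemma k_expression_edges:
  assumes "finite V" "V \<noteq> {}" "inj_on f V" "f ` V \<subseteq> {1..k}" "finite F"
    and "\<forall>e\<in>F. e \<subseteq> V \<and> card e = 2"
  shows "\<exists>t. k_expression k t \<and> cw_verts t = V \<and> cw_edges t = F \<and> (\<forall>x\<in>V. cw_lab t x = f x)"
  using assms(5,6)
proof (induction F rule: finite_induct)
  case empty
  show ?case using k_expression_vertices[OF assms(1,2,4)] .
next
  case (insert e F)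
  then obtain t where t: "k_expression k t" "cw_verts t = V" "cw_edges t = F"
      "\<forall>x\<in>V. cw_lab t x = f x"
    by auto
  from insert obtain a b where e: "e = {a, b}" "a \<noteq> b"
    by (auto simp: card_2_iff)
  with insert have ab: "a \<in> V" "b \<in> V" by auto
  have ne: "f a \<noteq> f b" using ab e assms(3) by (auto dest: inj_onD)
  have "{{x, y} | x y. x \<in> V \<and> y \<in> V \<and> cw_lab t x = f a \<and> cw_lab t y = f b} = {e}"
    using t(4) ab e assms(3) by (auto dest: inj_onD)
  then have "cw_edges (Join (f a) (f b) t) = insert e F"
    using t by auto
  then show ?case using t ne ab assms(4)
    by (intro exI[of _ "Join (f a) (f b) t"]) auto
qed

lemma clique_width_attained:
  assumes "simple_graph V E" "V \<noteq> {}"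
  shows "\<exists>t. k_expression (clique_width V E) t \<and> cw_verts t = V \<and> cw_edges t = E"
proof -
  have fin: "finite V" "\<forall>e\<in>E. e \<subseteq> V \<and> card e = 2"
    using assms(1) by (auto simp: simple_graph_def)
  have "finite E" using fin by (intro finite_subset[of E "Pow V"]) auto
  obtain f where f: "bij_betw f V {1..card V}"
    using fin(1) by (metis card_atLeastAtMost diff_Suc_1 finite_atLeastAtMost finite_same_card_bij)
  then have "inj_on f V" "f ` V \<subseteq> {1..card V}" by (auto simp: bij_betw_def)
  then have "\<exists>t. k_expression (card V) t \<and> cw_verts t = V \<and> cw_edges t = E"
    using k_expression_edges[OF fin(1) assms(2) _ _ \<open>finite E\<close> fin(2)] by metis
  then show ?thesis unfolding clique_width_def by (rule LeastI)
qed

end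

theory Submission
  imports Defs "HOL-Analysis.Analysis"
begin

text \<open>Since the union has maximum degree at most 7, clique-width at most \<open>k\<close> gives a vertex set \<open>A\<close> with
  \<open>n/3 \<le> |A| \<le> 2n/3\<close> and at most \<open>7k\<close> boundary vertices. In a balanced \<open>b\<close>-ary tree \<open>|A|\<close> is a signed sum
  of boundedly many subtree sizes (plus possibly \<open>n\<close>), and the subtree of a vertex at level \<open>l\<close> has
  \<open>n/b\<^sup>l\<close> vertices up to an error of 2. Hence \<open>|A|/n\<close> is within \<open>O(k/n)\<close> of a signed sum of boundedly
  many powers of 1/2 and also of a signed sum of boundedly many powers of 1/3. The sets of such sums
  are compact and have only integers in common, so away from the integers they have positive
  distance, which is a contradiction for large \<open>n\<close>.\<close>

section \<open>Signed sums of powers\<close>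

text \<open>Each half is a null sequence together with its limit 0, hence compact for
  \<open>b \<ge> 2\<close>. As 0 is a permitted summand, \<open>signed_sums b m\<close> covers all
  sums of at most \<open>m\<close> signed powers.\<close>

definition signed_powers :: "nat \<Rightarrow> real set" where
  "signed_powers b = insert 0 (range (\<lambda>l. 1 / real b ^ l)) \<union> insert 0 (range (\<lambda>l. - (1 / real b ^ l)))"

primrec signed_sums :: "nat \<Rightarrow> nat \<Rightarrow> real set" where
  "signed_sums b 0 = {0}"
| "signed_sums b (Suc m) = {x + y | x y. x \<in> signed_sums b m \<and> y \<in> signed_powers b}"

text \<open>The powers accumulate only at 0, which was added, and the sum of two compact sets is
  compact.\<close>

lemma compact_signed_sums:
  assumes "b \<ge> 2"
  shows "compact (signed_sums b m)"
proof -
  have lim: "(\<lambda>l. 1 / real b ^ l) \<longlonglongrightarrow> 0"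
    using assms LIMSEQ_power_zero[of "1 / real b"] by (simp add: power_one_over)
  have "compact (signed_powers b)"
    unfolding signed_powers_def
    using compact_sequence_with_limit[OF lim] compact_sequence_with_limit[OF tendsto_minus[OF lim]]
    by (intro compact_Un) auto
  then show ?thesis
    by (induction m) (auto intro: compact_sums)
qed

lemma signed_sums_mono:
  assumes "m \<le> m'"
  shows "signed_sums b m \<subseteq> signed_sums b m'"
proof -
  have "signed_sums b m \<subseteq> signed_sums b (Suc m)" for m
    by (force simp: signed_powers_def)
  then show ?thesis using assms by (rule lift_Suc_mono_le)
qed

lemma signed_sums_sum:
  assumes "finite Y" "\<And>y. y \<in> Y \<Longrightarrow> \<epsilon> y \<in> {-1, 0, 1}"
  shows "(\<Sum>y\<in>Y. \<epsilon> y / real b ^ l y) \<in> signed_sums b (card Y)"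
  using assms
proof (induction Y)
  case (insert y Y)
  have "\<epsilon> y / real b ^ l y \<in> signed_powers b"
    using insert.prems[of y] by (auto simp: signed_powers_def)
  with insert have "(\<Sum>y\<in>Y. \<epsilon> y / real b ^ l y) + \<epsilon> y / real b ^ l y \<in> signed_sums b (Suc (card Y))"
    by auto
  with insert show ?case by (simp add: add.commute)
qed simp

lemma signed_sums_denominator:
  assumes "x \<in> signed_sums b m" "b \<ge> 1"
  obtains N where "real b ^ N * x \<in> \<int>"
proof -
  have pow: "\<exists>N. real b ^ N * y \<in> \<int>" if "y \<in> signed_powers b" for y
  proof -
    from that consider "y = 0" | l where "y = 1 / real b ^ l" | l where "y = - (1 / real b ^ l)"
      by (auto simp: signed_powers_def)
    then show ?thesis
    proof cases
      case (2 l)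
      with assms(2) show ?thesis by (intro exI[of _ l]) simp
    next
      case (3 l)
      with assms(2) show ?thesis by (intro exI[of _ l]) simp
    qed auto
  qed
  have "\<exists>N. real b ^ N * x \<in> \<int>" using assms(1)
  proof (induction m arbitrary: x)
    case (Suc m)
    then obtain y z where x: "x = y + z" "y \<in> signed_sums b m" "z \<in> signed_powers b" by auto
    then obtain N M where NM: "real b ^ N * y \<in> \<int>" "real b ^ M * z \<in> \<int>"
      using Suc.IH pow by meson
    have "real b ^ (N + M) * x = of_nat (b ^ M) * (real b ^ N * y) + of_nat (b ^ N) * (real b ^ M * z)"
      by (simp add: x power_add algebra_simps)
    also have "\<dots> \<in> \<int>" using NM by (intro Ints_add Ints_mult[OF Ints_of_nat])
    finally show ?case ..
  qed simp
  with that show ?thesis by blast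
qed

text \<open>The denominator of \<open>x\<close> divides a power of \<open>a\<close> and a power of
  \<open>b\<close>. These powers are coprime, so a Bezout combination of the two integral multiples
  of \<open>x\<close> is \<open>x\<close> itself.\<close>

lemma common_signed_sum_int:
  assumes "x \<in> signed_sums a m" "x \<in> signed_sums b m'" "coprime a b" "a \<ge> 1" "b \<ge> 1"
  shows "x \<in> \<int>"
proof -
  obtain N M where NM: "real a ^ N * x \<in> \<int>" "real b ^ M * x \<in> \<int>"
    using assms signed_sums_denominator by metis
  have "coprime (int a ^ N) (int b ^ M)" using assms(3) by simp
  then obtain u v where "u * int a ^ N + v * int b ^ M = 1"
    using bezout_int[of "int a ^ N" "int b ^ M"] by auto
  then have "of_int (u * int a ^ N + v * int b ^ M) = (1 :: real)" by simp
  then have "x = (of_int u * real a ^ N + of_int v * real b ^ M) * x" by simp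
  also have "\<dots> = of_int u * (real a ^ N * x) + of_int v * (real b ^ M * x)"
    by (simp add: algebra_simps)
  also have "\<dots> \<in> \<int>" using NM by (intro Ints_add Ints_mult[OF Ints_of_int])
  finally show ?thesis .
qed

text \<open>The window from 1/4 to 3/4 contains no integer, so its compact part of the first set is
  disjoint from the closed second set. It is wider than the range from 1/3 to 2/3 of the cut sizes
  in order to absorb the approximation error.\<close>

lemma signed_sums_separated:
  assumes "coprime a b" "a \<ge> 2" "b \<ge> 2"
  obtains \<delta> where "\<delta> > 0"
    "\<And>u v. u \<in> signed_sums a m \<Longrightarrow> v \<in> signed_sums b m' \<Longrightarrow> 1/4 \<le> u \<Longrightarrow> u \<le> 3/4 \<Longrightarrow> \<delta> \<le> \<bar>u - v\<bar>"
proof -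
  have "signed_sums a m \<inter> {1/4..3/4} \<inter> signed_sums b m' = {}"
  proof (rule ccontr)
    assume "\<not> ?thesis"
    then obtain x where x: "x \<in> signed_sums a m" "x \<in> signed_sums b m'" "1/4 \<le> x" "x \<le> 3/4" by auto
    then have "x \<in> \<int>" using common_signed_sum_int assms by force
    then obtain i where "x = of_int i" by (auto elim: Ints_cases)
    with x have "0 < i" "i < 1" by linarith+
    then show False by simp
  qed
  moreover have "compact (signed_sums a m \<inter> {1/4..3/4})" "closed (signed_sums b m')"
    using compact_signed_sums assms by (auto intro: compact_imp_closed)
  ultimately obtain d where "d > 0" "\<forall>x\<in>signed_sums a m \<inter> {1/4..3/4}. \<forall>y\<in>signed_sums b m'. d \<le> dist x y"
    using separate_compact_closed by metis
  with that show ?thesis by (auto simp: dist_real_def)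
qed


section \<open>Trees\<close>

lemma adj_sym: "(x, y) \<in> adj E \<longleftrightarrow> (y, x) \<in> adj E"
  by (simp add: adj_def insert_commute)

lemma rtrancl_adj_sym: "(x, y) \<in> (adj E)\<^sup>* \<Longrightarrow> (y, x) \<in> (adj E)\<^sup>*"
  using sym_rtrancl[of "adj E"] by (auto simp: sym_def adj_sym)

lemma distinct_path:
  assumes "(u, v) \<in> (adj E)\<^sup>*"
  obtains xs where "xs \<noteq> []" "hd xs = u" "last xs = v" "distinct xs" "successively (\<lambda>x y. {x, y} \<in> E) xs"
proof -
  have "\<exists>xs. xs \<noteq> [] \<and> hd xs = u \<and> last xs = v \<and> distinct xs \<and> successively (\<lambda>x y. {x, y} \<in> E) xs"
    using assms
  proof (induction rule: rtrancl_induct)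
    case base
    show ?case by (intro exI[of _ "[u]"]) simp
  next
    case (step y z)
    then obtain xs where xs: "xs \<noteq> []" "hd xs = u" "last xs = y" "distinct xs"
      "successively (\<lambda>x y. {x, y} \<in> E) xs" by auto
    show ?case
    proof (cases "z \<in> set xs")
      \<comment> \<open>The walk returns to a visited vertex, so the path is truncated there instead
        of being extended.\<close>
      case True
      then obtain as bs where "xs = as @ z # bs" by (auto dest: split_list)
      with xs show ?thesis
        by (intro exI[of _ "as @ [z]"]) (auto simp: successively_append_iff hd_append)
    next
      case False
      with xs step show ?thesis
        by (intro exI[of _ "xs @ [z]"]) (auto simp: successively_append_iff hd_append adj_def)
    qed
  qed
  with that show ?thesis by blast
qed

text \<open>A path from \<open>u\<close> to \<open>v\<close> avoiding the edge would close up with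
  it to a cycle.\<close>

lemma tree_edge_bridge:
  assumes "is_tree V E" "{u, v} \<in> E"
  shows "(u, v) \<notin> (adj (E - {{u, v}}))\<^sup>*"
proof
  assume "(u, v) \<in> (adj (E - {{u, v}}))\<^sup>*"
  then obtain xs where xs: "xs \<noteq> []" "hd xs = u" "last xs = v" "distinct xs"
    "successively (\<lambda>x y. {x, y} \<in> E - {{u, v}}) xs"
    by (rule distinct_path)
  have "u \<noteq> v" using assms by (auto simp: is_tree_def simple_graph_def)
  with xs obtain a c ys where eq: "xs = a # c # ys"
    by (metis last.simps list.sel(1) neq_Nil_conv)
  \<comment> \<open>A path with only two vertices would be the deleted edge itself.\<close>
  with xs have "ys \<noteq> []" by auto
  with eq have "length xs \<ge> 3" by (cases ys) auto
  moreover have "successively (\<lambda>x y. {x, y} \<in> E) xs"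
    using xs(5) by (rule successively_mono) auto
  moreover have "{last xs, hd xs} \<in> E" using xs assms(2) by (simp add: insert_commute)
  ultimately have "is_cycle E xs" using xs by (simp add: is_cycle_def)
  with assms(1) show False by (auto simp: is_tree_def)
qed

section \<open>Rooted trees: depths, parents and subtree sizes\<close>

locale rooted_tree =
  fixes V :: "'a set" and E :: "'a set set" and r :: 'a
  assumes tree: "is_tree V E" and root: "r \<in> V"
begin

abbreviation depth :: "'a \<Rightarrow> nat" where "depth \<equiv> graph_dist E r"
abbreviation children :: "'a \<Rightarrow> 'a set" where "children x \<equiv> child_rel E r `` {x}"

definition parent :: "'a \<Rightarrow> 'a" where "parent y = (THE x. (x, y) \<in> child_rel E r)"

definition weight :: "'a \<Rightarrow> nat" where "weight x = card (subtree E r x)"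

lemma finite_V: "finite V"
  using tree by (simp add: is_tree_def simple_graph_def)

lemma edge_verts: "{x, y} \<in> E \<Longrightarrow> x \<in> V \<and> y \<in> V"
  using tree by (auto simp: is_tree_def simple_graph_def)

lemma depth_path:
  assumes "x \<in> V"
  shows "(r, x) \<in> adj E ^^ depth x"
proof -
  have "(r, x) \<in> (adj E)\<^sup>*" using tree root assms by (auto simp: is_tree_def connected_graph_def)
  then obtain n where "(r, x) \<in> adj E ^^ n" by (auto dest: rtrancl_imp_relpow)
  then show ?thesis unfolding graph_dist_def by (rule LeastI)
qed

lemma depth_le: "(r, x) \<in> adj E ^^ n \<Longrightarrow> depth x \<le> n"
  unfolding graph_dist_def by (rule Least_le)

lemma depth_root [simp]: "depth r = 0"
  using depth_le[of r 0] by simp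

lemma depth_eq_0: "x \<in> V \<Longrightarrow> depth x = 0 \<Longrightarrow> x = r"
  using depth_path[of x] by simp

lemma depth_edge_le:
  assumes "{x, y} \<in> E"
  shows "depth y \<le> Suc (depth x)"
  using depth_path[of x] edge_verts[OF assms] assms
  by (intro depth_le) (auto simp: adj_def)

lemma ex_parent:
  assumes "x \<in> V" "x \<noteq> r"
  obtains p where "{p, x} \<in> E" "depth x = Suc (depth p)"
proof -
  obtain l where l: "depth x = Suc l" using depth_eq_0 assms not0_implies_Suc by blast
  with depth_path[OF assms(1)] obtain p where p: "(r, p) \<in> adj E ^^ l" "(p, x) \<in> adj E" by auto
  then have "depth p \<le> l" by (intro depth_le)
  moreover have "depth x \<le> Suc (depth p)" using p by (intro depth_edge_le) (simp add: adj_def)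
  ultimately show ?thesis using that[of p] l p by (simp add: adj_def)
qed

text \<open>Climbing from \<open>x\<close> towards the root uses only edges whose lower end is no
  deeper than \<open>x\<close>. With \<open>F\<close> the edge set minus one edge, this keeps
  vertices connected to the root and so contradicts \<open>tree_edge_bridge\<close>.\<close>

lemma descend_to_root:
  assumes "x \<in> V"
    and "\<And>p y. {p, y} \<in> E \<Longrightarrow> depth y = Suc (depth p) \<Longrightarrow> depth y \<le> depth x \<Longrightarrow> {p, y} \<in> F"
  shows "(x, r) \<in> (adj F)\<^sup>*"
  using assms
proof (induction "depth x" arbitrary: x)
  case 0
  then show ?case using depth_eq_0 by auto
next
  case (Suc l)
  then have "x \<noteq> r" by auto
  then obtain p where p: "{p, x} \<in> E" "depth x = Suc (depth p)" using ex_parent Suc.prems by blast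
  with edge_verts Suc have "(p, r) \<in> (adj F)\<^sup>*" by auto
  moreover have "(x, p) \<in> adj F" using p Suc.prems(2)[of p x] by (simp add: adj_def insert_commute)
  ultimately show ?case by (rule converse_rtrancl_into_rtrancl[rotated])
qed

lemma depth_edge_neq:
  assumes "{x, y} \<in> E"
  shows "depth x \<noteq> depth y"
proof
  assume eq: "depth x = depth y"
  have "(z, r) \<in> (adj (E - {{x, y}}))\<^sup>*" if "z \<in> V" for z
    using that eq by (intro descend_to_root) (auto simp: doubleton_eq_iff)
  with edge_verts[OF assms] have "(x, y) \<in> (adj (E - {{x, y}}))\<^sup>*"
    by (meson rtrancl_adj_sym rtrancl_trans)
  with tree_edge_bridge[OF tree assms] show False by simp
qed

lemma child_iff: "(x, y) \<in> child_rel E r \<longleftrightarrow> {x, y} \<in> E \<and> depth y = Suc (depth x)"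
  by (simp add: child_rel_def)

lemma edge_child: "{x, y} \<in> E \<Longrightarrow> (x, y) \<in> child_rel E r \<or> (y, x) \<in> child_rel E r"
  using depth_edge_le[of x y] depth_edge_le[of y x] depth_edge_neq[of x y]
  by (auto simp: child_iff insert_commute)

text \<open>After deletion of \<open>{x, y}\<close>, both parents still reach the root through
  vertices above \<open>y\<close>, and \<open>y\<close> is still attached to \<open>x'\<close>. So
  \<open>x\<close> and \<open>y\<close> remain connected, although the edge is a bridge.\<close>

lemma parent_unique:
  assumes "(x, y) \<in> child_rel E r" "(x', y) \<in> child_rel E r"
  shows "x = x'"
proof (rule ccontr)
  assume ne: "x \<noteq> x'"
  let ?F = "E - {{x, y}}"
  from assms have e: "{x, y} \<in> E" "{x', y} \<in> E" "depth y = Suc (depth x)" "depth x' = depth x"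
    by (auto simp: child_iff)
  have "(z, r) \<in> (adj ?F)\<^sup>*" if "z \<in> V" "depth z = depth x" for z
  proof (rule descend_to_root[OF that(1)])
    fix p w assume w: "{p, w} \<in> E" "depth w = Suc (depth p)" "depth w \<le> depth z"
    with that(2) e(3) have "w \<noteq> y" "p \<noteq> y" by auto
    with w(1) show "{p, w} \<in> ?F" by (auto simp: doubleton_eq_iff)
  qed
  with edge_verts e have "(x, r) \<in> (adj ?F)\<^sup>*" "(x', r) \<in> (adj ?F)\<^sup>*" by metis+
  moreover have "(x', y) \<in> adj ?F" using e ne by (auto simp: adj_def doubleton_eq_iff)
  ultimately have "(x, y) \<in> (adj ?F)\<^sup>*"
    by (meson rtrancl_adj_sym rtrancl_trans r_into_rtrancl)
  with tree_edge_bridge[OF tree e(1)] show False by simp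
qed

lemma parent_child: "(x, y) \<in> child_rel E r \<Longrightarrow> parent y = x"
  unfolding parent_def using parent_unique by (intro the_equality)

lemma parent_rel: "y \<in> V \<Longrightarrow> y \<noteq> r \<Longrightarrow> (parent y, y) \<in> child_rel E r"
  using ex_parent[of y] parent_child[of _ y] by (metis child_iff)

lemma children_subset: "children x \<subseteq> V - {r}"
  using edge_verts by (auto simp: child_iff)

lemma finite_children: "finite (children x)"
  using children_subset finite_V by (meson finite_Diff finite_subset)

lemma descendant_depth: "(x, y) \<in> (child_rel E r)\<^sup>* \<Longrightarrow> x = y \<or> depth x < depth y"
  by (induction rule: rtrancl_induct) (auto simp: child_iff)

lemma subtree_subset: "x \<in> V \<Longrightarrow> subtree E r x \<subseteq> V"
proof
  fix y assume x: "x \<in> V" and "y \<in> subtree E r x"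
  then have "(x, y) \<in> (child_rel E r)\<^sup>*" by (simp add: subtree_def)
  then show "y \<in> V" using x by (induction rule: rtrancl_induct) (auto simp: child_iff edge_verts)
qed

lemma subtree_root: "subtree E r r = V"
proof
  have "(r, x) \<in> (child_rel E r)\<^sup>*" if "x \<in> V" for x
    using that
  proof (induction "depth x" arbitrary: x)
    case 0
    then show ?case using depth_eq_0 by auto
  next
    case (Suc l)
    then have "x \<noteq> r" by auto
    with Suc have p: "(parent x, x) \<in> child_rel E r" using parent_rel by simp
    then have "parent x \<in> V" "depth x = Suc (depth (parent x))" using edge_verts by (auto simp: child_iff)
    with Suc have "(r, parent x) \<in> (child_rel E r)\<^sup>*" by simp
    with p show ?case by auto
  qed
  then show "V \<subseteq> subtree E r r" by (auto simp: subtree_def)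
qed (simp add: subtree_subset root)

lemma weight_rec:
  assumes "x \<in> V"
  shows "weight x = Suc (\<Sum>c\<in>children x. weight c)"
proof -
  let ?T = "\<lambda>c. subtree E r c"
  have fin: "finite (?T c)" if "c \<in> V" for c
    using that subtree_subset finite_V finite_subset by blast
  have "?T x = insert x (\<Union>c\<in>children x. ?T c)"
    by (auto simp: subtree_def elim: converse_rtranclE intro: converse_rtrancl_into_rtrancl)
  moreover have "x \<notin> ?T c" if "c \<in> children x" for c
    using that descendant_depth[of c x] by (auto simp: subtree_def child_iff)
  moreover have "?T c \<inter> ?T c' = {}" if "c \<in> children x" "c' \<in> children x" "c \<noteq> c'" for c c'
  proof (rule ccontr)
    assume "?T c \<inter> ?T c' \<noteq> {}"
    then obtain z where z: "(c, z) \<in> (child_rel E r)\<^sup>*" "(c', z) \<in> (child_rel E r)\<^sup>*"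
      by (auto simp: subtree_def)
    \<comment> \<open>Since parents are unique, two ancestors of \<open>z\<close> are comparable,
      whereas distinct siblings have equal depth and are not.\<close>
    have "single_valued ((child_rel E r)\<inverse>)"
      using parent_unique by (auto intro: single_valuedI)
    with z have "(c, c') \<in> (child_rel E r)\<^sup>* \<or> (c', c) \<in> (child_rel E r)\<^sup>*"
      using single_valued_confluent[of "(child_rel E r)\<inverse>" z c c']
      by (auto simp: rtrancl_converse)
    then show False using that descendant_depth[of c c'] descendant_depth[of c' c]
      by (auto simp: child_iff)
  qed
  moreover have "finite (?T c)" if "c \<in> children x" for c
    using that children_subset fin by blast
  ultimately show ?thesis
    unfolding weight_def using finite_children
    by (simp add: card_UN_disjoint)
qed

lemma sum_children:
  assumes "X \<subseteq> V"
  shows "(\<Sum>x\<in>X. \<Sum>y\<in>children x. h y) = (\<Sum>y\<in>(\<Union>x\<in>X. children x). h y)"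
  using assms finite_V finite_children parent_unique
  by (intro sum.UNION_disjoint[symmetric]) (auto intro: finite_subset)

text \<open>Weighting the vertices by \<^term>\<open>weight\<close>, which drops by one plus the weights of the children,
  turns the count of \<open>A\<close> into a sum over the edges leaving \<open>A\<close>.\<close>

lemma card_eq_boundary_sum:
  assumes "A \<subseteq> V"
  shows "real (card A) = of_bool (r \<in> A) * real (card V)
    + (\<Sum>y\<in>V - {r}. (of_bool (y \<in> A) - of_bool (parent y \<in> A)) * real (weight y))"
proof -
  let ?a = "\<lambda>x. of_bool (x \<in> A) :: real"
  have UN: "(\<Union>x\<in>V. children x) = V - {r}"
  proof
    show "V - {r} \<subseteq> (\<Union>x\<in>V. children x)"
    proof
      fix y assume "y \<in> V - {r}"
      then have p: "(parent y, y) \<in> child_rel E r" using parent_rel by simp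
      then have "parent y \<in> V" using edge_verts by (auto simp: child_iff)
      with p show "y \<in> (\<Union>x\<in>V. children x)" by blast
    qed
  qed (use children_subset in blast)
  have "real (card A) = (\<Sum>x\<in>V. ?a x)"
    using assms finite_V by (simp add: Int_absorb1 sum.If_cases of_bool_def)
  also have "\<dots> = (\<Sum>x\<in>V. ?a x * real (weight x) - (\<Sum>y\<in>children x. ?a (parent y) * real (weight y)))"
  proof (rule sum.cong)
    fix x assume "x \<in> V"
    have "(\<Sum>y\<in>children x. ?a (parent y) * real (weight y)) = ?a x * (\<Sum>y\<in>children x. real (weight y))"
      unfolding sum_distrib_left using parent_child by (intro sum.cong) auto
    then show "?a x = ?a x * real (weight x) - (\<Sum>y\<in>children x. ?a (parent y) * real (weight y))"
      using weight_rec[OF \<open>x \<in> V\<close>] by (simp add: algebra_simps)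
  qed simp
  also have "\<dots> = (\<Sum>x\<in>V. ?a x * real (weight x)) - (\<Sum>y\<in>V - {r}. ?a (parent y) * real (weight y))"
    by (simp add: sum_subtractf sum_children UN)
  also have "(\<Sum>x\<in>V. ?a x * real (weight x))
      = ?a r * real (weight r) + (\<Sum>y\<in>V - {r}. ?a y * real (weight y))"
    using finite_V root by (rule sum.remove)
  finally show ?thesis
    by (simp add: sum_subtractf left_diff_distrib weight_def subtree_root)
qed

lemma level_Suc: "level V E r (Suc l) = (\<Union>x\<in>level V E r l. children x)"
proof
  show "level V E r (Suc l) \<subseteq> (\<Union>x\<in>level V E r l. children x)"
  proof
    fix y assume y: "y \<in> level V E r (Suc l)"
    then have "(parent y, y) \<in> child_rel E r" by (intro parent_rel) (auto simp: level_def)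
    with y show "y \<in> (\<Union>x\<in>level V E r l. children x)"
      using edge_verts by (auto simp: level_def child_iff)
  qed
  show "(\<Union>x\<in>level V E r l. children x) \<subseteq> level V E r (Suc l)"
    using edge_verts by (auto simp: level_def child_iff)
qed

lemma level_0: "level V E r 0 = {r}"
  using depth_eq_0 root by (auto simp: level_def)

lemma level_subset: "level V E r l \<subseteq> V"
  by (auto simp: level_def)

lemma finite_level: "finite (level V E r l)"
  using level_subset finite_V by (rule finite_subset)

text \<open>Passing from level \<open>l\<close> to the next one removes exactly the roots of the
  subtrees.\<close>

lemma sum_level_weight:
  "(\<Sum>x\<in>level V E r l. weight x) = card (level V E r l) + (\<Sum>x\<in>level V E r (Suc l). weight x)"
proof -
  have "(\<Sum>x\<in>level V E r l. weight x) = (\<Sum>x\<in>level V E r l. Suc (\<Sum>c\<in>children x. weight c))"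
    using weight_rec level_subset by (intro sum.cong) auto
  also have "\<dots> = card (level V E r l) + (\<Sum>x\<in>level V E r l. \<Sum>c\<in>children x. weight c)"
    by (simp add: sum_Suc)
  finally show ?thesis by (simp add: level_Suc sum_children level_subset)
qed

end

section \<open>Balanced trees: subtree sizes and the size of a vertex set with small
  boundary\<close>

locale balanced_rooted = rooted_tree V E r for V :: "'a set" and E r +
  fixes b :: nat
  assumes balanced: "balanced_rooted_tree b V E r" and b2: "b \<ge> 2"
begin

lemma card_children: "x \<in> V \<Longrightarrow> card (children x) \<le> b"
  using balanced by (simp add: balanced_rooted_tree_def bary_tree_def)

lemma card_level_le: "card (level V E r l) \<le> b ^ l"
proof (induction l)
  case (Suc l)
  have "card (level V E r (Suc l)) \<le> (\<Sum>x\<in>level V E r l. card (children x))"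
    unfolding level_Suc using finite_level by (rule card_UN_le)
  also have "\<dots> \<le> card (level V E r l) * b"
    using card_children level_subset by (intro sum_bounded_above[THEN order_trans]) auto
  also have "\<dots> \<le> b ^ l * b" using Suc by simp
  finally show ?case by (simp add: mult.commute)
qed (simp add: level_0)

lemma filled_level: "level V E r l \<noteq> {} \<Longrightarrow> level V E r m \<noteq> {} \<Longrightarrow> l < m \<Longrightarrow> card (level V E r l) = b ^ l"
  using balanced by (auto simp: balanced_rooted_tree_def)

text \<open>All levels above a non-empty level are filled, and the subtrees rooted at level
  \<open>l\<close> partition the remaining vertices.\<close>

lemma card_V_level:
  assumes "level V E r l \<noteq> {}"
  shows "card V = (\<Sum>i<l. b ^ i) + (\<Sum>x\<in>level V E r l. weight x)"
  using assms
proof (induction l)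
  case 0
  show ?case by (simp add: level_0 weight_def subtree_root)
next
  case (Suc l)
  then have ne: "level V E r l \<noteq> {}" by (auto simp: level_Suc)
  with Suc have "card (level V E r l) = b ^ l" by (intro filled_level) auto
  with Suc.IH[OF ne] sum_level_weight[of l] show ?case by simp
qed

lemma geometric_le: "(\<Sum>i<l. b ^ i) \<le> b ^ l"
proof (induction l)
  case (Suc l)
  then have "(\<Sum>i<Suc l. b ^ i) \<le> 2 * b ^ l" by simp
  also have "\<dots> \<le> b * b ^ l" using b2 by (intro mult_right_mono) auto
  finally show ?case by simp
qed simp

text \<open>Two errors of at most \<open>b ^ l\<close> arise: the vertices above level
  \<open>l\<close>, and the deviation of the total weight of the level from \<open>b ^ l\<close>
  copies of \<open>weight x\<close>. Division by \<open>b ^ l\<close> leaves 2.\<close>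

lemma weight_approx:
  assumes "x \<in> V"
  shows "\<bar>real (weight x) - real (card V) / real b ^ depth x\<bar> \<le> 2"
proof -
  define l where "l = depth x"
  let ?L = "level V E r l"
  let ?S = "\<Sum>y\<in>?L. real (weight y)"
  let ?G = "real (\<Sum>i<l. b ^ i)"
  have x: "x \<in> ?L" using assms by (simp add: l_def level_def)
  then have "real (card V) = real ((\<Sum>i<l. b ^ i) + (\<Sum>y\<in>?L. weight y))"
    by (subst card_V_level[of l]) auto
  then have n: "real (card V) = ?G + ?S" by simp
  have G: "0 \<le> ?G" "?G \<le> real b ^ l"
    using geometric_le[of l] of_nat_mono[OF geometric_le[of l], where ?'a = real] by (auto intro: sum_nonneg)
  have S: "\<bar>?S - real b ^ l * real (weight x)\<bar> \<le> real b ^ l"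
  proof (cases "level V E r (Suc l) = {}")
    \<comment> \<open>The last level may be unfilled, but its subtrees are single vertices and there
      are at most \<open>b ^ l\<close> of them.\<close>
    case True
    have "weight y = 1" if "y \<in> ?L" for y
      using that True weight_rec[of y] level_subset by (auto simp: level_Suc)
    with x have "?S = real (card ?L)" "weight x = 1" by auto
    moreover have "real (card ?L) \<le> real b ^ l" using card_level_le[of l] by (metis of_nat_le_iff of_nat_power)
    ultimately show ?thesis by simp
  next
    case False
    \<comment> \<open>The level is filled, so balance contributes an error of at most 1 for each of
      its \<open>b ^ l\<close> vertices.\<close>
    with x have card: "card ?L = b ^ l" by (intro filled_level[of l "Suc l"]) auto
    then have "?S - real b ^ l * real (weight x) = (\<Sum>y\<in>?L. real (weight y) - real (weight x))"
      by (simp add: sum_subtractf)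
    also have "\<bar>\<dots>\<bar> \<le> (\<Sum>y\<in>?L. \<bar>real (weight y) - real (weight x)\<bar>)" by (rule sum_abs)
    also have "\<dots> \<le> (\<Sum>y\<in>?L. 1)"
    proof (rule sum_mono)
      fix y assume "y \<in> ?L"
      with x balanced have "\<bar>int (weight y) - int (weight x)\<bar> \<le> 1"
        unfolding weight_def by (auto simp: balanced_rooted_tree_def)
      then show "\<bar>real (weight y) - real (weight x)\<bar> \<le> 1" by linarith
    qed
    finally show ?thesis using card by simp
  qed
  have B: "real b ^ l > 0" using b2 by simp
  have "real (weight x) - real (card V) / real b ^ l = (real b ^ l * real (weight x) - real (card V)) / real b ^ l"
    using B by (simp add: field_simps)
  also have "\<bar>\<dots>\<bar> = \<bar>real b ^ l * real (weight x) - real (card V)\<bar> / real b ^ l"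
    using B by simp
  also have "\<dots> \<le> (2 * real b ^ l) / real b ^ l"
    using B n G S by (intro divide_right_mono) linarith+
  also have "\<dots> = 2" using B by simp
  finally show ?thesis by (simp add: l_def)
qed

lemma degree_le:
  assumes "x \<in> V"
  shows "card {y. {x, y} \<in> E} \<le> b + 1"
proof -
  have "{y. {x, y} \<in> E} \<subseteq> insert (parent x) (children x)"
    using edge_child parent_child by fastforce
  then have "card {y. {x, y} \<in> E} \<le> card (insert (parent x) (children x))"
    using finite_children by (intro card_mono) auto
  also have "\<dots> \<le> Suc (card (children x))" by (rule card_insert_le_m1) auto
  finally show ?thesis using card_children[OF assms] by simp
qed

text \<open>In \<open>card_eq_boundary_sum\<close> only vertices separated by \<open>A\<close> from
  their parent contribute. Each is a boundary vertex or a child of one, which gives at most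
  \<open>(b + 1) * m\<close> terms. Replacing each subtree size by its approximation costs 2 per
  term.\<close>

lemma card_approx_signed_sum:
  assumes "A \<subseteq> V" "card {x \<in> A. \<exists>z\<in>V - A. {x, z} \<in> E} \<le> m"
  obtains u where "u \<in> signed_sums b (Suc ((b + 1) * m))"
    "\<bar>real (card A) - real (card V) * u\<bar> \<le> 2 * ((b + 1) * m)"
proof -
  define M where "M = {x \<in> A. \<exists>z\<in>V - A. {x, z} \<in> E}"
  define Y where "Y = {y \<in> V - {r}. (y \<in> A) \<noteq> (parent y \<in> A)}"
  define \<epsilon> where "\<epsilon> y = (of_bool (y \<in> A) - of_bool (parent y \<in> A) :: real)" for y
  have finM: "finite M" using assms(1) finite_V by (auto simp: M_def intro: finite_subset)
  have finY: "finite Y" using finite_V by (simp add: Y_def)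
  have "Y \<subseteq> M \<union> (\<Union>x\<in>M. children x)"
  proof
    fix y assume y: "y \<in> Y"
    then have p: "(parent y, y) \<in> child_rel E r" by (intro parent_rel) (auto simp: Y_def)
    then have e: "{parent y, y} \<in> E" "{y, parent y} \<in> E" by (auto simp: child_iff insert_commute)
    then have "y \<in> M \<or> parent y \<in> M" using y edge_verts by (auto simp: Y_def M_def)
    with p show "y \<in> M \<union> (\<Union>x\<in>M. children x)" by auto
  qed
  then have "card Y \<le> card (M \<union> (\<Union>x\<in>M. children x))"
    using finM finite_children by (intro card_mono) auto
  also have "\<dots> \<le> card M + (\<Sum>x\<in>M. card (children x))"
    using card_UN_le[OF finM, of children] by (intro order_trans[OF card_Un_le]) simp
  also have "\<dots> \<le> card M + card M * b"
    using card_children assms(1) sum_bounded_above[of M "\<lambda>x. card (children x)" b]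
    by (auto simp: M_def)
  also have "\<dots> = (b + 1) * card M" by simp
  also have "\<dots> \<le> (b + 1) * m" using assms(2) by (intro mult_left_mono) (auto simp: M_def)
  finally have cardY: "card Y \<le> (b + 1) * m" .
  define s where "s = (\<Sum>y\<in>Y. \<epsilon> y / real b ^ depth y)"
  \<comment> \<open>The root term is 0 or \<open>1 / b ^ 0\<close> and accounts for the extra
    summand in \<open>Suc\<close>.\<close>
  define u where "u = s + of_bool (r \<in> A)"
  have "s \<in> signed_sums b (card Y)"
    unfolding s_def using finY by (intro signed_sums_sum) (auto simp: \<epsilon>_def)
  then have "s \<in> signed_sums b ((b + 1) * m)" using signed_sums_mono[OF cardY] by auto
  moreover have "of_bool (r \<in> A) \<in> signed_powers b"
    by (auto simp: signed_powers_def image_iff intro: exI[of _ 0])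
  ultimately have u: "u \<in> signed_sums b (Suc ((b + 1) * m))" unfolding u_def signed_sums.simps by blast
  have "(\<Sum>y\<in>V - {r}. \<epsilon> y * real (weight y)) = (\<Sum>y\<in>Y. \<epsilon> y * real (weight y))"
    using finite_V by (intro sum.mono_neutral_right) (auto simp: Y_def \<epsilon>_def)
  with card_eq_boundary_sum[OF assms(1)]
  have "real (card A) = of_bool (r \<in> A) * real (card V) + (\<Sum>y\<in>Y. \<epsilon> y * real (weight y))"
    by (simp add: \<epsilon>_def)
  then have "real (card A) - real (card V) * u
      = (\<Sum>y\<in>Y. \<epsilon> y * real (weight y)) - real (card V) * s"
    by (simp add: u_def algebra_simps)
  also have "\<dots> = (\<Sum>y\<in>Y. \<epsilon> y * (real (weight y) - real (card V) / real b ^ depth y))"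
    by (simp add: s_def sum_distrib_left sum_subtractf right_diff_distrib mult.commute)
  also have "\<bar>\<dots>\<bar> \<le> (\<Sum>y\<in>Y. \<bar>\<epsilon> y * (real (weight y) - real (card V) / real b ^ depth y)\<bar>)"
    by (rule sum_abs)
  also have "\<dots> \<le> (\<Sum>y\<in>Y. 2)"
  proof (rule sum_mono)
    fix y assume y: "y \<in> Y"
    then have "\<bar>\<epsilon> y\<bar> \<le> 1" "\<bar>real (weight y) - real (card V) / real b ^ depth y\<bar> \<le> 2"
      using weight_approx[of y] by (auto simp: Y_def \<epsilon>_def)
    then have "\<bar>\<epsilon> y\<bar> * \<bar>real (weight y) - real (card V) / real b ^ depth y\<bar> \<le> 1 * 2"
      by (intro mult_mono) auto
    then show "\<bar>\<epsilon> y * (real (weight y) - real (card V) / real b ^ depth y)\<bar> \<le> 2"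
      by (simp add: abs_mult)
  qed
  also have "\<dots> \<le> 2 * ((b + 1) * m)"
    using of_nat_mono[OF cardY, where ?'a = real] by simp
  finally show ?thesis using that u by blast
qed

end

lemma balanced_tree_rooted:
  assumes "balanced_tree b V E" "b \<ge> 2"
  obtains r where "balanced_rooted V E r b"
proof -
  obtain r where "balanced_rooted_tree b V E r" using assms(1) by (auto simp: balanced_tree_def)
  then have "balanced_rooted V E r b"
    using assms(2) by unfold_locales (auto simp: balanced_rooted_tree_def bary_tree_def)
  with that show ?thesis .
qed


section \<open>Clique-width and cuts\<close>

lemma cw_edges_subset: "e \<in> cw_edges t \<Longrightarrow> e \<subseteq> cw_verts t"
  by (induction t) auto

lemma finite_cw_verts: "finite (cw_verts t)"
  by (induction t) auto

lemma cw_lab_range: "k_expression k t \<Longrightarrow> x \<in> cw_verts t \<Longrightarrow> cw_lab t x \<in> {1..k}"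
  by (induction t) auto

text \<open>Here \<open>A\<close> stands for the vertex set of a subexpression of \<open>t\<close>
  and \<open>f\<close> for the labels inside that subexpression. Operations applied later cannot
  tell vertices of equal \<open>f\<close> apart. Equality of the current labels is the invariant
  that carries this through further joins.\<close>

definition cw_cut :: "nat \<Rightarrow> 'a cw_expr \<Rightarrow> 'a set \<Rightarrow> ('a \<Rightarrow> nat) \<Rightarrow> bool" where
  "cw_cut k t A f \<longleftrightarrow> A \<subseteq> cw_verts t \<and> f ` A \<subseteq> {1..k} \<and>
    (\<forall>x\<in>A. \<forall>y\<in>A. f x = f y \<longrightarrow> cw_lab t x = cw_lab t y \<and>
      (\<forall>z\<in>cw_verts t - A. {x, z} \<in> cw_edges t \<longleftrightarrow> {y, z} \<in> cw_edges t))"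

lemma cw_cut_lab: "cw_cut k t A f \<Longrightarrow> x \<in> A \<Longrightarrow> y \<in> A \<Longrightarrow> f x = f y \<Longrightarrow> cw_lab t x = cw_lab t y"
  unfolding cw_cut_def by blast

lemma cw_cut_edge:
  "cw_cut k t A f \<Longrightarrow> x \<in> A \<Longrightarrow> y \<in> A \<Longrightarrow> f x = f y \<Longrightarrow> z \<in> cw_verts t - A \<Longrightarrow>
    {x, z} \<in> cw_edges t \<longleftrightarrow> {y, z} \<in> cw_edges t"
  unfolding cw_cut_def by blast

lemma cw_cut_self: "k_expression k t \<Longrightarrow> cw_cut k t (cw_verts t) (cw_lab t)"
  using cw_lab_range[of k t] by (auto simp: cw_cut_def)

lemma cw_cut_DUnion1:
  assumes "cw_cut k s A f" "cw_verts s \<inter> cw_verts t = {}"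
  shows "cw_cut k (DUnion s t) A f"
proof -
  have A: "A \<subseteq> cw_verts s" using assms(1) by (simp add: cw_cut_def)
  \<comment> \<open>The other operand sends no edges to \<open>A\<close>, so for its vertices both
    sides of the neighbourhood condition are false.\<close>
  have edge: "{x, z} \<in> cw_edges (DUnion s t) \<longleftrightarrow> z \<in> cw_verts s \<and> {x, z} \<in> cw_edges s"
    if "x \<in> A" for x z
    using that A assms(2) cw_edges_subset[of "{x, z}" s] cw_edges_subset[of "{x, z}" t] by auto
  have lab: "cw_lab (DUnion s t) x = cw_lab s x" if "x \<in> A" for x
    using that A by auto
  show ?thesis unfolding cw_cut_def
  proof (intro conjI ballI impI)
    show "A \<subseteq> cw_verts (DUnion s t)" "f ` A \<subseteq> {1..k}"
      using A assms(1) by (auto simp: cw_cut_def)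
  next
    fix x y assume xy: "x \<in> A" "y \<in> A" "f x = f y"
    then show "cw_lab (DUnion s t) x = cw_lab (DUnion s t) y"
      using lab cw_cut_lab[OF assms(1) xy] by simp
    fix z assume "z \<in> cw_verts (DUnion s t) - A"
    then show "{x, z} \<in> cw_edges (DUnion s t) \<longleftrightarrow> {y, z} \<in> cw_edges (DUnion s t)"
      using edge xy cw_cut_edge[OF assms(1) xy, of z] by blast
  qed
qed

lemma cw_cut_DUnion2:
  assumes "cw_cut k t A f" "cw_verts s \<inter> cw_verts t = {}"
  shows "cw_cut k (DUnion s t) A f"
proof -
  have A: "A \<subseteq> cw_verts t" using assms(1) by (simp add: cw_cut_def)
  have edge: "{x, z} \<in> cw_edges (DUnion s t) \<longleftrightarrow> z \<in> cw_verts t \<and> {x, z} \<in> cw_edges t"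
    if "x \<in> A" for x z
    using that A assms(2) cw_edges_subset[of "{x, z}" s] cw_edges_subset[of "{x, z}" t] by auto
  have lab: "cw_lab (DUnion s t) x = cw_lab t x" if "x \<in> A" for x
    using that A assms(2) by auto
  show ?thesis unfolding cw_cut_def
  proof (intro conjI ballI impI)
    show "A \<subseteq> cw_verts (DUnion s t)" "f ` A \<subseteq> {1..k}"
      using A assms(1) by (auto simp: cw_cut_def)
  next
    fix x y assume xy: "x \<in> A" "y \<in> A" "f x = f y"
    then show "cw_lab (DUnion s t) x = cw_lab (DUnion s t) y"
      using lab cw_cut_lab[OF assms(1) xy] by simp
    fix z assume "z \<in> cw_verts (DUnion s t) - A"
    then show "{x, z} \<in> cw_edges (DUnion s t) \<longleftrightarrow> {y, z} \<in> cw_edges (DUnion s t)"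
      using edge xy cw_cut_edge[OF assms(1) xy, of z] by blast
  qed
qed

text \<open>A join adds edges according to labels alone, and vertices with equal \<open>f\<close>
  still share their label.\<close>

lemma cw_cut_Join:
  assumes "cw_cut k t A f"
  shows "cw_cut k (Join i j t) A f"
  unfolding cw_cut_def
proof (intro conjI ballI impI)
  have A: "A \<subseteq> cw_verts t" using assms by (simp add: cw_cut_def)
  then show "A \<subseteq> cw_verts (Join i j t)" by simp
  show "f ` A \<subseteq> {1..k}" using assms by (simp add: cw_cut_def)
  fix x y assume xy: "x \<in> A" "y \<in> A" "f x = f y"
  show lab: "cw_lab (Join i j t) x = cw_lab (Join i j t) y"
    using cw_cut_lab[OF assms xy] by simp
  fix z assume "z \<in> cw_verts (Join i j t) - A"
  then have z: "z \<in> cw_verts t - A" by simp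
  have "{w, z} \<in> cw_edges (Join i j t) \<longleftrightarrow> {w, z} \<in> cw_edges t \<or>
      cw_lab t w = i \<and> cw_lab t z = j \<or> cw_lab t w = j \<and> cw_lab t z = i" if "w \<in> A" for w
    using that z A by (simp add: doubleton_eq_iff) blast
  then show "{x, z} \<in> cw_edges (Join i j t) \<longleftrightarrow> {y, z} \<in> cw_edges (Join i j t)"
    using lab xy cw_cut_edge[OF assms xy z] by (simp del: cw_edges.simps)
qed

lemma cw_cut_Relabel: "cw_cut k t A f \<Longrightarrow> cw_cut k (Relabel i j t) A f"
  unfolding cw_cut_def cw_verts.simps cw_edges.simps cw_lab.simps by metis

text \<open>Descend in the expression. A union with more than \<open>2 * N / 3\<close> vertices has
  an operand with at least \<open>N / 3\<close>; either that operand is small enough to be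
  \<open>A\<close>, or the descent continues in it. \<open>N\<close> stays fixed while the
  expression shrinks, and \<open>N \<ge> 2\<close> rules out arriving at a single vertex that is
  still too large.\<close>

lemma balanced_cw_cut:
  assumes "k_expression k t" "N \<ge> 2" "2 * N < 3 * card (cw_verts t)"
  shows "\<exists>A f. cw_cut k t A f \<and> N \<le> 3 * card A \<and> 3 * card A \<le> 2 * N"
  using assms
proof (induction t)
  case (DUnion s t)
  show ?case
  proof -
    have *: "\<exists>A f. cw_cut k u A f \<and> N \<le> 3 * card A \<and> 3 * card A \<le> 2 * N"
      if "N \<le> 3 * card (cw_verts u)" "u = s \<or> u = t" for u
    proof (cases "3 * card (cw_verts u) \<le> 2 * N")
      case True
      then show ?thesis using that cw_cut_self[of k u] DUnion.prems by auto
    next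
      case False
      then show ?thesis using that DUnion by auto
    qed
    have "card (cw_verts s \<union> cw_verts t) \<le> card (cw_verts s) + card (cw_verts t)"
      by (rule card_Un_le)
    then have "N \<le> 3 * card (cw_verts s) \<or> N \<le> 3 * card (cw_verts t)"
      using DUnion.prems by simp linarith
    then show ?thesis
      using * cw_cut_DUnion1[of k s _ _ t] cw_cut_DUnion2[of k t _ _ s] DUnion.prems by fastforce
  qed
next
  case (Join i j t)
  then show ?case using cw_cut_Join by fastforce
next
  case (Relabel i j t)
  then show ?case using cw_cut_Relabel by fastforce
qed simp

text \<open>All boundary vertices with one label have a common neighbour outside \<open>A\<close>, so each label
  occurs on the boundary at most as often as the maximum degree.\<close>

lemma cw_cut_boundary:
  assumes "cw_cut k t A f" and "\<And>z. z \<in> cw_verts t \<Longrightarrow> card {y. {z, y} \<in> cw_edges t} \<le> d"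
  shows "card {x \<in> A. \<exists>z\<in>cw_verts t - A. {x, z} \<in> cw_edges t} \<le> k * d"
proof -
  let ?M = "{x \<in> A. \<exists>z\<in>cw_verts t - A. {x, z} \<in> cw_edges t}"
  have A: "A \<subseteq> cw_verts t" "f ` A \<subseteq> {1..k}" using assms(1) by (auto simp: cw_cut_def)
  have cl: "card {x \<in> ?M. f x = i} \<le> d" for i
  proof (cases "{x \<in> ?M. f x = i} = {}")
    case False
    then obtain x z where xz: "x \<in> A" "f x = i" "z \<in> cw_verts t - A" "{x, z} \<in> cw_edges t" by auto
    have "{z, y} \<in> cw_edges t" if "y \<in> A" "f y = i" for y
      using that xz cw_cut_edge[OF assms(1), of x y z] by (simp add: insert_commute)
    then have "{x \<in> ?M. f x = i} \<subseteq> {y. {z, y} \<in> cw_edges t}" by auto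
    moreover have "{y. {z, y} \<in> cw_edges t} \<subseteq> cw_verts t" using cw_edges_subset[of _ t] by auto
    then have "finite {y. {z, y} \<in> cw_edges t}" using finite_cw_verts finite_subset by blast
    ultimately show ?thesis using assms(2)[of z] xz(3) by (meson DiffD1 card_mono order_trans)
  next
    case True
    then show ?thesis by (simp only: card.empty)
  qed
  have "?M = (\<Union>i\<in>{1..k}. {x \<in> ?M. f x = i})" using A by auto
  then have "card ?M = card (\<Union>i\<in>{1..k}. {x \<in> ?M. f x = i})" by (rule arg_cong)
  also have "\<dots> \<le> (\<Sum>i\<in>{1..k}. card {x \<in> ?M. f x = i})" by (rule card_UN_le) simp
  also have "\<dots> \<le> k * d" using cl sum_bounded_above[of "{1..k}" "\<lambda>i. card {x \<in> ?M. f x = i}" d] by simp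
  finally show ?thesis .
qed


section \<open>Unions of two trees\<close>

lemma union_along_simple:
  assumes "\<phi> permutes V" "simple_graph V E" "simple_graph V F"
  shows "simple_graph V (union_along \<phi> E F)"
proof -
  have "{\<phi> i, \<phi> j} \<subseteq> V \<and> card {\<phi> i, \<phi> j} = 2" if "{i, j} \<in> E" for i j
  proof -
    have "i \<in> V" "j \<in> V" "i \<noteq> j" using that assms(2) by (auto simp: simple_graph_def)
    moreover have "inj \<phi>" using assms(1) by (rule permutes_inj)
    ultimately show ?thesis using permutes_in_image[OF assms(1)] by (auto simp: inj_eq)
  qed
  with assms(2,3) show ?thesis by (auto simp: simple_graph_def union_along_def)
qed

lemma union_along_degree:
  assumes \<phi>: "\<phi> permutes V" and "balanced_rooted V E r b" "balanced_rooted V F r' b'" "z \<in> V"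
  shows "card {y. {z, y} \<in> union_along \<phi> E F} \<le> (b + 1) + (b' + 1)"
proof -
  interpret E: balanced_rooted V E r b by fact
  interpret F: balanced_rooted V F r' b' by fact
  \<comment> \<open>The neighbours of \<open>z\<close> in the permuted tree are the images of the
    neighbours of its preimage \<open>w\<close>.\<close>
  define w where "w = inv \<phi> z"
  have w: "w \<in> V" "z = \<phi> w"
    using assms by (simp_all add: w_def permutes_inverses permutes_in_image[OF permutes_inv[OF \<phi>]])
  have inj: "inj \<phi>" using \<phi> by (rule permutes_inj)
  have "{y. {z, y} \<in> union_along \<phi> E F} \<subseteq> \<phi> ` {y. {w, y} \<in> E} \<union> {y. {z, y} \<in> F}"
    using inj by (auto simp: union_along_def w doubleton_eq_iff insert_commute dest: injD)
  moreover have fin: "finite {y. {w, y} \<in> E}" "finite {y. {z, y} \<in> F}"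
    using E.edge_verts F.edge_verts E.finite_V by (auto intro: finite_subset[of _ V])
  ultimately have "card {y. {z, y} \<in> union_along \<phi> E F} \<le> card (\<phi> ` {y. {w, y} \<in> E} \<union> {y. {z, y} \<in> F})"
    by (intro card_mono) auto
  also have "\<dots> \<le> card {y. {w, y} \<in> E} + card {y. {z, y} \<in> F}"
    using card_image_le[OF fin(1), of \<phi>] by (intro order_trans[OF card_Un_le]) simp
  also have "\<dots> \<le> (b + 1) + (b' + 1)"
    using E.degree_le F.degree_le w assms by (intro add_mono) auto
  finally show ?thesis .
qed

section \<open>The contradiction for large \<open>n\<close>\<close>

theorem theorem11:
  fixes T :: "nat \<Rightarrow> nat \<Rightarrow> nat set set" and c :: real
  assumes "\<And>b n. b \<in> {2, 3} \<Longrightarrow> n \<ge> 1 \<Longrightarrow> balanced_tree b {1..n} (T b n)"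
    and "c > 0"
  shows "\<exists>n\<ge>1. \<forall>\<phi>. \<phi> permutes {1..n} \<longrightarrow>
    real (clique_width {1..n} (union_along \<phi> (T 2 n) (T 3 n))) > c"
proof -
  define k where "k = nat \<lfloor>c\<rfloor>"
  \<comment> \<open>The degree bound is 7 = (2 + 1) + (3 + 1), so \<open>m\<close> bounds the
    boundary of a cut if the clique-width is at most \<open>k\<close>.\<close>
  define m where "m = k * 7"
  obtain \<delta> where \<delta>: "\<delta> > 0"
    "\<And>u v. u \<in> signed_sums 2 (Suc (3 * m)) \<Longrightarrow> v \<in> signed_sums 3 (Suc (4 * m)) \<Longrightarrow>
      1/4 \<le> u \<Longrightarrow> u \<le> 3/4 \<Longrightarrow> \<delta> \<le> \<bar>u - v\<bar>"
    using signed_sums_separated[of 2 3 "Suc (3 * m)" "Suc (4 * m)"] by auto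
  \<comment> \<open>The first term makes the combined error 6m + 8m smaller than
    \<open>\<delta> * n\<close>. The second makes 6m smaller than n/12, the margin between 1/3 and
    1/4.\<close>
  obtain n where n: "real n > 14 * m / \<delta> + 72 * m + 2" using reals_Archimedean2 by blast
  have "0 \<le> 14 * real m / \<delta>" using \<delta>(1) by simp
  with n have n2: "n \<ge> 2" and n72: "real n > 72 * m" by linarith+
  have "14 * m / \<delta> < real n" using n by linarith
  with \<delta>(1) have n\<delta>: "14 * m < \<delta> * real n" by (simp add: field_simps)
  show ?thesis
  proof (intro exI[of _ n] conjI allI impI)
    fix \<phi> assume \<phi>: "\<phi> permutes {1..n}"
    let ?V = "{1..n}" let ?G = "union_along \<phi> (T 2 n) (T 3 n)"
    obtain r2 where T2: "balanced_rooted ?V (T 2 n) r2 2"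
      using assms(1)[of 2 n] n2 by (auto intro: balanced_tree_rooted)
    obtain r3 where T3: "balanced_rooted ?V (T 3 n) r3 3"
      using assms(1)[of 3 n] n2 by (auto intro: balanced_tree_rooted)
    interpret T2: balanced_rooted ?V "T 2 n" r2 2 by fact
    interpret T3: balanced_rooted ?V "T 3 n" r3 3 by fact
    have "simple_graph ?V ?G"
      using \<phi> T2.tree T3.tree by (intro union_along_simple) (auto simp: is_tree_def)
    moreover have "?V \<noteq> {}" using n2 by auto
    ultimately obtain t where t: "k_expression (clique_width ?V ?G) t" "cw_verts t = ?V" "cw_edges t = ?G"
      using clique_width_attained by blast
    show "real (clique_width ?V ?G) > c"
    proof (rule ccontr)
      assume "\<not> ?thesis"
      then have k: "clique_width ?V ?G \<le> k" unfolding k_def by linarith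
      obtain A f where A: "cw_cut (clique_width ?V ?G) t A f" "n \<le> 3 * card A" "3 * card A \<le> 2 * n"
        using balanced_cw_cut[OF t(1), of n] t(2) n2 by auto
      have AV: "A \<subseteq> ?V" using A(1) t(2) by (simp add: cw_cut_def)
      let ?M = "{x \<in> A. \<exists>z\<in>?V - A. {x, z} \<in> ?G}"
      have "card ?M \<le> clique_width ?V ?G * 7"
        using cw_cut_boundary[OF A(1), of 7] union_along_degree[OF \<phi> T2 T3] t by simp
      with k have M: "card ?M \<le> m" unfolding m_def by linarith
      have finM: "finite ?M" using AV by (auto intro: finite_subset)
      have "card {x \<in> A. \<exists>z\<in>?V - A. {x, z} \<in> T 3 n} \<le> card ?M"
        using finM by (rule card_mono) (auto simp: union_along_def)
      with M obtain v where v: "v \<in> signed_sums 3 (Suc (4 * m))"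
        "\<bar>real (card A) - real n * v\<bar> \<le> 8 * m"
        using T3.card_approx_signed_sum[OF AV, of m] by (auto simp del: signed_sums.simps)
      \<comment> \<open>The binary tree enters the union through \<phi>, so the cut is pulled back.
        Its size is unchanged, and \<phi> maps its boundary in the binary tree into the boundary of
        \<open>A\<close>.\<close>
      define A' where "A' = {i \<in> ?V. \<phi> i \<in> A}"
      have inj: "inj \<phi>" using \<phi> by (rule permutes_inj)
      have "A \<subseteq> \<phi> ` ?V" using AV permutes_image[OF \<phi>] by simp
      then have "\<phi> ` A' = A" unfolding A'_def by blast
      then have cardA': "card A' = card A" using inj by (metis card_image inj_on_subset subset_UNIV)
      let ?M' = "{x \<in> A'. \<exists>z\<in>?V - A'. {x, z} \<in> T 2 n}"
      have "\<phi> ` ?M' \<subseteq> ?M"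
        using permutes_in_image[OF \<phi>] by (fastforce simp: A'_def union_along_def)
      then have "card ?M' \<le> card ?M"
        using finM inj by (meson card_inj_on_le inj_on_subset subset_UNIV)
      with M have "card ?M' \<le> m" by simp
      moreover have "A' \<subseteq> ?V" by (auto simp: A'_def)
      ultimately obtain u where "u \<in> signed_sums 2 (Suc ((2 + 1) * m))"
        "\<bar>real (card A') - real (card ?V) * u\<bar> \<le> 2 * ((2 + 1) * m)"
        using T2.card_approx_signed_sum by blast
      then have u: "u \<in> signed_sums 2 (Suc (3 * m))" "\<bar>real (card A) - real n * u\<bar> \<le> 6 * m"
        using cardA' by (simp_all del: signed_sums.simps)
      have npos: "real n > 0" using n2 by simp
      \<comment> \<open>The size of \<open>A\<close> lies between n/3 and 2n/3, and
        \<open>n * u\<close> differs from it by at most 6m, which is less than n/12.\<close>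
      have "real n * (1/4) \<le> real n * u" "real n * u \<le> real n * (3/4)"
        using u(2) A(2,3) n72 by linarith+
      with npos have "1/4 \<le> u" "u \<le> 3/4" by (simp_all only: mult_le_cancel_left_pos)
      with \<delta>(2) u v have "\<delta> \<le> \<bar>u - v\<bar>" by blast
      then have "\<delta> * real n \<le> \<bar>u - v\<bar> * real n" using npos by simp
      also have "\<dots> = \<bar>real n * u - real n * v\<bar>"
        using npos by (simp add: abs_mult flip: right_diff_distrib)
      also have "\<dots> \<le> 14 * m" using u(2) v(2) by linarith
      finally show False using n\<delta> by simp
    qed
  qed (use n2 in simp)
qed

end
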